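(* Let $\omega\in\Omega$ and let $\mathcal P^{\mathbb 1(\omega)}$ be the set of partitions (finite multisets) with parts in $E_1$ such that, with $f_u$ the multiplicity of $u\in E_1$ and fictitious frequencies $f_u=\chi(u=\mathbb 1(\omega))$ for $u\in E_{-1}\setminus E_1$, one has $f_{e_0}+\dots+f_{e_m}\le1$ for all paths $(e_0,\dots,e_m)$ in $E_{-1}$. Then $$\sum_{\pi\in\mathcal P^{\mathbb 1(\omega)}}q^{|\pi|}=\mathbb 1\Bigl(c(\omega)^{-1}q^{-|\omega|}\sum_{\pi\in\mathcal P^{\omega}_\rho}C(\pi)q^{|\pi|}\Bigr).$$
   Context: $m\ge1$, $\mathcal O=\{1<\dots<m\}$, $\overline x=m+1-x$, $\chi$ = truth value. Primary-coloured integers $k_{c_j}$ ($k\in\mathbb Z$, $j\in\mathcal O$); secondary colours $c_{x,y}=c_xc_y$ ($x\le y$), secondary-coloured integers $k_{c_{x,y}}$ form $\mathbb Z_{\mathcal S}$, with $\eta(2k_{c_{x,y}})=k_{c_y}$, $\zeta(2k_{c_{x,y}})=k_{c_x}$, $\eta((2k+1)_{c_{x,y}})=(k+1)_{c_x}$, $\zeta((2k+1)_{c_{x,y}})=k_{c_y}$. $\rho(c_{x',y'},c_{x,y})=\chi(x\ge x')+\chi(y\ge y')-\chi(y\ge y'>x\ge x')$, $k_c\gg_\rho l_d$ iff $k-l\ge\rho(c,d)$. $\omega_0=(-1)_{c_{m,m}}$, $\omega_i=0_{c_{i,\overline{i+1}}}$ ($1\le i\le\lfloor m/2\rfloor$),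 $\Omega=\{\omega_u:0\le u\le\lfloor m/2\rfloor\}\sqcup\{0_{c_{u,\overline u}}:1\le u\le\lceil m/2\rceil\}$. $\mathcal P^\omega_\rho$: sequences $(\pi_0,\dots,\pi_{s-1},\omega)$ in $\mathbb Z_{\mathcal S}$ with consecutive parts related by $\gg_\rho$; $|\pi|$ = sum of sizes, $C(\pi)$ = product of colours of all parts. $\mathbb 1(k_{c_j})=km-\frac{m+1}{2}+j$ for primary-coloured integers; for $e\in\mathbb Z_{\mathcal S}$, $\mathbb 1(e)$ is the symbol $l_d$ with size $l=\mathbb 1(\eta(e))+\mathbb 1(\zeta(e))$ and subscript $d=\mathbb 1(\eta(e))-\mathbb 1(\zeta(e))\in\{0,\dots,m\}$. For $k\in\mathbb Z\cup\{-\infty\}$, $E_k=\{l_d:l\ge k,\ d\in\{0,\dots,m\},\ l-d\equiv m+1\pmod 2\}$. A path in $E_k$ is a sequence $((l^{(0)})_0,\dots,(l^{(m)})_m)$ of elements of $E_k$ with $l^{(j+1)}=l^{(j)}\pm1$. The size of a partition with parts in $E_1$ is the sum of the sizes $l$. On generating functions, $\mathbb 1$ is the substitution $q\mapsto q^m$, $c_j\mapsto q^{j-\frac{m+1}{2}}$, under which $c(e)q^{|e|}\mapsto q^{\text{size of }\mathbb 1(e)}$ for each $e\in\mathbb Z_{\mathcal S}$. *)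

theory Defs
  imports Complex_Main "HOL-Library.Multiset" "HOL-Library.Poly_Mapping" "HOL-Library.Product_Plus"
begin

text \<open>
  The pair \<open>(k, j)\<close> is the primary-coloured integer with size \<open>k\<close> and colour \<open>c_j\<close>; the triple
  \<open>(k, x, y)\<close> is the secondary-coloured integer with size \<open>k\<close> and colour \<open>c_{x,y} = c_x c_y\<close>;
  the pair \<open>(l, d)\<close> in \<open>symb\<close> is the symbol \<open>l_d\<close>.
\<close>

type_synonym prim = "int \<times> nat"
type_synonym sec = "int \<times> nat \<times> nat"
type_synonym symb = "int \<times> int"

definition ZS :: "nat \<Rightarrow> sec set" where
  "ZS m = {(k, x, y). 1 \<le> x \<and> x \<le> y \<and> y \<le> m}"

fun eta :: "sec \<Rightarrow> prim" where
  "eta (k, x, y) = (if even k then (k div 2, y) else (k div 2 + 1, x))"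

fun zeta :: "sec \<Rightarrow> prim" where
  "zeta (k, x, y) = (if even k then (k div 2, x) else (k div 2, y))"

fun rho :: "nat \<times> nat \<Rightarrow> nat \<times> nat \<Rightarrow> int" where
  "rho (x', y') (x, y) =
     of_bool (x \<ge> x') + of_bool (y \<ge> y') - of_bool (y \<ge> y' \<and> y' > x \<and> x \<ge> x')"

definition gg_rho :: "sec \<Rightarrow> sec \<Rightarrow> bool" where
  "gg_rho e f \<longleftrightarrow> fst e - fst f \<ge> rho (snd e) (snd f)"

definition bar :: "nat \<Rightarrow> nat \<Rightarrow> nat" where
  "bar m x = m + 1 - x"

definition omega :: "nat \<Rightarrow> nat \<Rightarrow> sec" where
  "omega m i = (if i = 0 then (-1, m, m) else (0, i, bar m (i + 1)))"

definition Omega :: "nat \<Rightarrow> sec set" where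
  "Omega m = omega m ` {0..m div 2} \<union> (\<lambda>u. (0, u, bar m u)) ` {1..(m + 1) div 2}"

definition P_rho :: "nat \<Rightarrow> sec \<Rightarrow> sec list set" where
  "P_rho m w = {\<pi>. set \<pi> \<subseteq> ZS m \<and> \<pi> \<noteq> [] \<and> last \<pi> = w \<and> successively gg_rho \<pi>}"

definition one_prim :: "nat \<Rightarrow> prim \<Rightarrow> rat" where
  "one_prim m p = of_int (fst p) * of_nat m - (of_nat m + 1) / 2 + of_nat (snd p)"

text \<open>
  The sum and difference below are integers although their two terms may be half-integers
  (see \<open>of_int_one_sec\<close>), so the floors only change the type.
\<close>

definition one_sec :: "nat \<Rightarrow> sec \<Rightarrow> symb" where
  "one_sec m e =
     (\<lfloor>one_prim m (eta e) + one_prim m (zeta e)\<rfloor>, \<lfloor>one_prim m (eta e) - one_prim m (zeta e)\<rfloor>)"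

definition E :: "nat \<Rightarrow> int \<Rightarrow> symb set" where
  "E m k = {(l, d). l \<ge> k \<and> d \<in> {0..int m} \<and> (l - d) mod 2 = (int m + 1) mod 2}"

definition is_path :: "nat \<Rightarrow> int \<Rightarrow> symb list \<Rightarrow> bool" where
  "is_path m k es \<longleftrightarrow> length es = m + 1 \<and>
     (\<forall>j\<le>m. es ! j \<in> E m k \<and> snd (es ! j) = int j) \<and>
     (\<forall>j<m. fst (es ! (j + 1)) = fst (es ! j) + 1 \<or> fst (es ! (j + 1)) = fst (es ! j) - 1)"

text \<open>Frequencies, including the fictitious ones on \<open>E m (-1) - E m 1\<close>; \<open>w\<close> is a symbol.\<close>

definition freq :: "nat \<Rightarrow> symb \<Rightarrow> symb multiset \<Rightarrow> symb \<Rightarrow> nat" where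
  "freq m w \<pi> u = (if u \<in> E m 1 then count \<pi> u else of_bool (u = w))"

definition P_one :: "nat \<Rightarrow> symb \<Rightarrow> symb multiset set" where
  "P_one m w = {\<pi>. set_mset \<pi> \<subseteq> E m 1 \<and>
     (\<forall>es. is_path m (-1) es \<longrightarrow> (\<Sum>e\<leftarrow>es. freq m w \<pi> e) \<le> 1)}"

definition size_one :: "symb multiset \<Rightarrow> int" where
  "size_one \<pi> = (\<Sum>u\<in>#\<pi>. fst u)"

text \<open>
  A Laurent monomial \<open>q^k c_1^{a_1} ... c_m^{a_m}\<close> is written additively as the pair \<open>(k, a)\<close> of
  its exponents. Formal series in \<open>q, c_1, ..., c_m\<close>, and formal series in \<open>q\<close> with rational
  exponents, are given by their coefficient functions.
\<close>

type_synonym mono = "int \<times> (nat \<Rightarrow>\<^sub>0 int)"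

fun sec_mono :: "sec \<Rightarrow> mono" where
  "sec_mono (k, x, y) = (k, Poly_Mapping.single x 1 + Poly_Mapping.single y 1)"

definition seq_mono :: "sec list \<Rightarrow> mono" where
  "seq_mono \<pi> = (\<Sum>e\<leftarrow>\<pi>. sec_mono e)"

text \<open>
  \<open>gen_series wt S\<close> is the sum of the monomials \<open>wt \<pi>\<close> over \<open>\<pi> \<in> S\<close>, meaningful if
  \<open>gen_series_defined wt S\<close>.
\<close>

definition gen_series :: "('a \<Rightarrow> 'b) \<Rightarrow> 'a set \<Rightarrow> 'b \<Rightarrow> int" where
  "gen_series wt S = (\<lambda>\<mu>. int (card {\<pi> \<in> S. wt \<pi> = \<mu>}))"

definition gen_series_defined :: "('a \<Rightarrow> 'b) \<Rightarrow> 'a set \<Rightarrow> bool" where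
  "gen_series_defined wt S \<longleftrightarrow> (\<forall>\<mu>. finite {\<pi> \<in> S. wt \<pi> = \<mu>})"

definition monom_times :: "mono \<Rightarrow> (mono \<Rightarrow> int) \<Rightarrow> mono \<Rightarrow> int" where
  "monom_times \<nu> F = (\<lambda>\<mu>. F (\<mu> - \<nu>))"

text \<open>
  The exponent of \<open>q\<close> after the substitution of \<open>q^m\<close> for \<open>q\<close> and of \<open>q^{j-(m+1)/2}\<close> for \<open>c_j\<close>
  in a monomial, and the substitution in a series: it is meaningful if only finitely many
  monomials of the series are sent to each power of \<open>q\<close>.
\<close>

definition one_expo :: "nat \<Rightarrow> mono \<Rightarrow> rat" where
  "one_expo m \<mu> = of_nat m * of_int (fst \<mu>)
     + (\<Sum>j=1..m. of_int (Poly_Mapping.lookup (snd \<mu>) j) * (of_nat j - (of_nat m + 1) / 2))"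

definition one_series :: "nat \<Rightarrow> (mono \<Rightarrow> int) \<Rightarrow> rat \<Rightarrow> int" where
  "one_series m F = (\<lambda>N. \<Sum>\<mu> | F \<mu> \<noteq> 0 \<and> one_expo m \<mu> = N. F \<mu>)"

definition one_series_defined :: "nat \<Rightarrow> (mono \<Rightarrow> int) \<Rightarrow> bool" where
  "one_series_defined m F \<longleftrightarrow> (\<forall>N. finite {\<mu>. F \<mu> \<noteq> 0 \<and> one_expo m \<mu> = N})"

lemma of_int_one_sec:
  "of_int (fst (one_sec m e)) = one_prim m (eta e) + one_prim m (zeta e)"
  "of_int (snd (one_sec m e)) = one_prim m (eta e) - one_prim m (zeta e)"
proof -
  obtain a i b j where *: "eta e = (a, i)" "zeta e = (b, j)" by fastforce
  have s: "one_prim m (eta e) + one_prim m (zeta e)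
      = of_int ((a + b) * int m - (int m + 1) + int i + int j)"
    by (simp add: * one_prim_def field_simps)
  have d: "one_prim m (eta e) - one_prim m (zeta e) = of_int ((a - b) * int m + int i - int j)"
    by (simp add: * one_prim_def field_simps)
  show "of_int (fst (one_sec m e)) = one_prim m (eta e) + one_prim m (zeta e)"
    unfolding one_sec_def fst_conv s floor_of_int ..
  show "of_int (snd (one_sec m e)) = one_prim m (eta e) - one_prim m (zeta e)"
    unfolding one_sec_def snd_conv d floor_of_int ..
qed

lemma one_expo_sec_mono:
  assumes "e \<in> ZS m"
  shows "one_expo m (sec_mono e) = of_int (fst (one_sec m e))"
proof -
  obtain k x y where e: "e = (k, x, y)" by (cases e)
  with assms have xy: "x \<in> {1..m}" "y \<in> {1..m}" by (auto simp: ZS_def)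
  have "one_expo m (sec_mono e)
      = of_nat m * of_int k + (\<Sum>j=1..m. (if j = x then of_nat j - (of_nat m + 1) / 2 else 0)
          + (if j = y then of_nat j - (of_nat m + 1) / 2 else 0))"
    unfolding one_expo_def e
    by (auto simp: lookup_add lookup_single when_def add_divide_distrib intro!: sum.cong)
  also have "\<dots> = of_nat m * of_int k + (of_nat x + of_nat y - (of_nat m + 1))"
    using xy unfolding sum.distrib by (simp add: field_simps)
  also have "\<dots> = one_prim m (eta e) + one_prim m (zeta e)"
  proof (cases "even k")
    case True
    then obtain n where "k = 2 * n" by blast
    then show ?thesis by (simp add: e one_prim_def field_simps)
  next
    case False
    then obtain n where "k = 2 * n + 1" by (elim oddE)
    then show ?thesis by (simp add: e one_prim_def field_simps)
  qed
  finally show ?thesis by (simp add: of_int_one_sec)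
qed

end

theory Submission
  imports Defs
begin

text \<open>
  Identify the primary-coloured integer \<open>k_{c_j}\<close> with the integer \<open>k m + j\<close>, and a
  secondary-coloured integer \<open>e\<close> with the pair \<open>(P, Q)\<close> of the integers of \<open>\<eta>(e)\<close> and \<open>\<zeta>(e)\<close>;
  these are exactly the pairs with \<open>0 \<le> P - Q \<le> m\<close>. Then \<open>e \<ggreater>\<^sub>\<rho> f\<close> means that both coordinates
  strictly decrease, i.e. that the symbols \<open>l_d\<close> and \<open>l'_{d'}\<close> of \<open>e\<close> and \<open>f\<close> satisfy
  \<open>l - l' > |d - d'|\<close>. Two symbols lie on a common path iff neither is above the other in this
  sense, so the condition on frequencies says that the parts together with the symbol of \<open>\<omega>\<close> form
  a chain. Since \<open>\<Omega>\<close> corresponds to the symbols of size \<open>-1\<close> and \<open>0\<close>, whatever is above \<open>\<omega>\<close>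
  automatically has positive size, and both sides count the same chains.
\<close>

section \<open>The strict order on symbols\<close>

definition strictly_above :: "symb \<Rightarrow> symb \<Rightarrow> bool" where
  "strictly_above u v \<longleftrightarrow> fst u - fst v > \<bar>snd u - snd v\<bar>"

lemma strictly_above_trans: "strictly_above u v \<Longrightarrow> strictly_above v t \<Longrightarrow> strictly_above u t"
  by (auto simp: strictly_above_def)

lemma strictly_above_asym: "strictly_above u v \<Longrightarrow> \<not> strictly_above v u"
  by (auto simp: strictly_above_def)

lemma transp_strictly_above: "transp strictly_above"
  by (auto intro: transpI strictly_above_trans)

text \<open>If the heads differed, each would occur in the tail of the other list and so be related
  to the other in both directions. This makes passing from chains to multisets injective.\<close>

lemma sorted_wrt_asym_unique:
  assumes asym: "\<And>x y. R x y \<Longrightarrow> \<not> R y x"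
  shows "sorted_wrt R xs \<Longrightarrow> sorted_wrt R ys \<Longrightarrow> mset xs = mset ys \<Longrightarrow> xs = ys"
proof (induction xs arbitrary: ys)
  case Nil
  then show ?case by simp
next
  case (Cons x xs)
  then obtain y zs where ys: "ys = y # zs" by (cases ys) auto
  have sets: "set (x # xs) = set (y # zs)"
    using Cons.prems(3) ys by (metis set_mset_mset)
  have "x = y"
  proof (rule ccontr)
    assume "x \<noteq> y"
    with sets have "x \<in> set zs" "y \<in> set xs" by auto
    with Cons.prems(1,2) ys have "R y x" "R x y" by auto
    with asym show False by blast
  qed
  with Cons ys show ?case by simp
qed


section \<open>Secondary-coloured integers as pairs of integers\<close>

text \<open>This is division by \<open>m\<close> with remainders in \<open>1..m\<close>: passing to
  a later block gains at least \<open>m\<close>, while two remainders differ by less than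
  \<open>m\<close>.\<close>

lemma block_less_iff:
  fixes a b m :: int and y z :: int
  assumes "1 \<le> y" "y \<le> m" "1 \<le> z" "z \<le> m"
  shows "a * m + y < b * m + z \<longleftrightarrow> a < b \<or> a = b \<and> y < z"
proof -
  have less: "a * m + y < b * m + z" if "a < b" "1 \<le> z" "y \<le> m" for a b y z
  proof -
    have "(a + 1) * m \<le> b * m" using that(1) assms by (intro mult_right_mono) auto
    with that show ?thesis by (simp add: algebra_simps)
  qed
  show ?thesis
    using less[of a b z y] less[of b a y z] assms by (cases a b rule: linorder_cases) auto
qed

lemma block_eq_iff:
  fixes a b m :: int and y z :: int
  assumes "1 \<le> y" "y \<le> m" "1 \<le> z" "z \<le> m"
  shows "a * m + y = b * m + z \<longleftrightarrow> a = b \<and> y = z"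
  using block_less_iff[of y m z a b] block_less_iff[of z m y b a] assms by linarith

text \<open>Each primary part contributes its integer minus \<open>(m + 1) / 2\<close>; these shifts
  add up in the size and cancel in the subscript. Sum and difference stay unexpanded to match
  \<open>above_pairs_iff\<close> and \<open>pairs_eq_iff\<close>.\<close>

lemma one_sec_even:
  "one_sec m (2 * a, x, y)
     = ((a * int m + int y) + (a * int m + int x) - (int m + 1),
        (a * int m + int y) - (a * int m + int x))"
proof -
  have "rat_of_int (fst (one_sec m (2 * a, x, y)))
      = of_int ((a * int m + int y) + (a * int m + int x) - (int m + 1))"
    "rat_of_int (snd (one_sec m (2 * a, x, y)))
      = of_int ((a * int m + int y) - (a * int m + int x))"
    unfolding of_int_one_sec by (simp_all add: one_prim_def field_simps)
  then show ?thesis unfolding of_int_eq_iff by (simp add: prod_eq_iff)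
qed

lemma one_sec_odd:
  "one_sec m (2 * a + 1, x, y)
     = (((a + 1) * int m + int x) + (a * int m + int y) - (int m + 1),
        ((a + 1) * int m + int x) - (a * int m + int y))"
proof -
  have "rat_of_int (fst (one_sec m (2 * a + 1, x, y)))
      = of_int (((a + 1) * int m + int x) + (a * int m + int y) - (int m + 1))"
    "rat_of_int (snd (one_sec m (2 * a + 1, x, y)))
      = of_int (((a + 1) * int m + int x) - (a * int m + int y))"
    unfolding of_int_one_sec by (simp_all add: one_prim_def field_simps)
  then show ?thesis unfolding of_int_eq_iff by (simp add: prod_eq_iff)
qed

text \<open>The size difference plus or minus the subscript difference is twice the decrease of
  \<open>P\<close> or of \<open>Q\<close>.\<close>

lemma above_pairs_iff:
  "strictly_above (P + Q - c, P - Q) (P' + Q' - c, P' - Q') \<longleftrightarrow> P' < P \<and> Q' < Q"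
  by (auto simp: strictly_above_def)

lemma pairs_eq_iff:
  "(P + Q - c, P - Q) = (P' + Q' - c, P' - Q') \<longleftrightarrow> P' = P \<and> Q' = (Q :: int)"
  by auto

lemma ZS_cases:
  assumes "e \<in> ZS m"
  obtains (even) a x y where "e = (2 * a, x, y)" "1 \<le> x" "x \<le> y" "y \<le> m"
  | (odd) a x y where "e = (2 * a + 1, x, y)" "1 \<le> x" "x \<le> y" "y \<le> m"
proof -
  obtain k x y where e: "e = (k, x, y)" "1 \<le> x" "x \<le> y" "y \<le> m"
    using assms by (auto simp: ZS_def)
  show ?thesis using e that by (cases "even k") (auto elim!: evenE oddE)
qed

text \<open>A size difference of at least 2 always suffices and a negative one never does.
  Difference 0 (equal parities) requires \<open>rho\<close> to vanish, i.e. \<open>x < x'\<close>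
  and \<open>y < y'\<close>; difference 1 (opposite parities) excludes only \<open>rho = 2\<close>,
  which for ordered indices means \<open>x \<ge> y'\<close>. These are the lexicographic block
  comparisons.\<close>

lemma gg_rho_iff_above:
  assumes "e \<in> ZS m" "f \<in> ZS m"
  shows "gg_rho e f \<longleftrightarrow> strictly_above (one_sec m e) (one_sec m f)"
  using assms(1)
proof (cases rule: ZS_cases)
  case e: (even a x' y')
  show ?thesis using assms(2)
  proof (cases rule: ZS_cases)
    case f: (even b x y)
    show ?thesis unfolding e(1) f(1) one_sec_even above_pairs_iff gg_rho_def
      using e f by (subst (1 2) block_less_iff) (auto simp: of_bool_def)
  next
    case f: (odd b x y)
    show ?thesis unfolding e(1) f(1) one_sec_even one_sec_odd above_pairs_iff gg_rho_def
      using e f by (subst (1 2) block_less_iff) (auto simp: of_bool_def)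
  qed
next
  case e: (odd a x' y')
  show ?thesis using assms(2)
  proof (cases rule: ZS_cases)
    case f: (even b x y)
    show ?thesis unfolding e(1) f(1) one_sec_even one_sec_odd above_pairs_iff gg_rho_def
      using e f by (subst (1 2) block_less_iff) (auto simp: of_bool_def)
  next
    case f: (odd b x y)
    show ?thesis unfolding e(1) f(1) one_sec_odd above_pairs_iff gg_rho_def
      using e f by (subst (1 2) block_less_iff) (auto simp: of_bool_def)
  qed
qed

text \<open>The size is even exactly if \<open>P\<close> and \<open>Q\<close> lie in the same block
  of length \<open>m\<close>, so the pair determines the parity and then all indices.\<close>

lemma inj_on_one_sec: "inj_on (one_sec m) (ZS m)"
proof (rule inj_onI)
  fix e f
  assume e: "e \<in> ZS m" and f: "f \<in> ZS m" and eq: "one_sec m e = one_sec m f"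
  from e show "e = f"
  proof (cases rule: ZS_cases)
    case e: (even a x' y')
    show ?thesis using f
    proof (cases rule: ZS_cases)
      case f: (even b x y)
      show ?thesis using eq unfolding e(1) f(1) one_sec_even pairs_eq_iff
        using e f by (subst (asm) (1 2) block_eq_iff) auto
    next
      case f: (odd b x y)
      show ?thesis using eq unfolding e(1) f(1) one_sec_even one_sec_odd pairs_eq_iff
        using e f by (subst (asm) (1 2) block_eq_iff) auto
    qed
  next
    case e: (odd a x' y')
    show ?thesis using f
    proof (cases rule: ZS_cases)
      case f: (even b x y)
      show ?thesis using eq unfolding e(1) f(1) one_sec_even one_sec_odd pairs_eq_iff
        using e f by (subst (asm) (1 2) block_eq_iff) auto
    next
      case f: (odd b x y)
      show ?thesis using eq unfolding e(1) f(1) one_sec_odd pairs_eq_iff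
        using e f by (subst (asm) (1 2) block_eq_iff) auto
    qed
  qed
qed

text \<open>The parity holds since \<open>l - d = 2 * Q - (m + 1)\<close>; the subscript is
  \<open>y - x\<close> for even and \<open>m - (y - x)\<close> for odd sizes.\<close>

lemma one_sec_in_E:
  assumes "e \<in> ZS m" "k \<le> fst (one_sec m e)"
  shows "one_sec m e \<in> E m k"
proof -
  have parity: "(P + Q - (int m + 1) - (P - Q)) mod 2 = (int m + 1) mod 2" for P Q
    by presburger
  from assms(1) show ?thesis
  proof (cases rule: ZS_cases)
    case e: (even a x y)
    then show ?thesis
      using assms(2) parity unfolding E_def e(1) one_sec_even mem_Collect_eq case_prod_conv
      by auto
  next
    case e: (odd a x y)
    then show ?thesis
      using assms(2) parity unfolding E_def e(1) one_sec_odd mem_Collect_eq case_prod_conv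
      by (simp add: distrib_right) presburger
  qed
qed

lemma one_sec_surj:
  assumes "m \<ge> 1" "u \<in> E m k"
  shows "u \<in> one_sec m ` ZS m"
proof -
  obtain l d where u: "u = (l, d)" "0 \<le> d" "d \<le> int m" "(l - d) mod 2 = (int m + 1) mod 2"
    using assms(2) by (auto simp: E_def)
  then have "even (l - d + (int m + 1))" by presburger
  then obtain Q where Q: "l - d + (int m + 1) = 2 * Q" by (elim evenE)
  define P where "P = Q + d"
  \<comment> \<open>Dividing \<open>N - 1\<close> instead of \<open>N\<close> moves the remainders
    from \<open>0..m-1\<close> to \<open>1..m\<close>.\<close>
  have split: "\<exists>a x. N = a * int m + int x \<and> 1 \<le> x \<and> x \<le> m" for N
  proof (intro exI conjI)
    have "(N - 1) mod int m \<ge> 0" "(N - 1) mod int m < int m"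
      using assms(1) by simp_all
    then show "N = (N - 1) div int m * int m + int (nat ((N - 1) mod int m + 1))"
      "1 \<le> nat ((N - 1) mod int m + 1)" "nat ((N - 1) mod int m + 1) \<le> m"
      using div_mult_mod_eq[of "N - 1" "int m"] by linarith+
  qed
  obtain a x where x: "Q = a * int m + int x" "1 \<le> x" "x \<le> m" using split by blast
  obtain b y where y: "P = b * int m + int y" "1 \<le> y" "y \<le> m" using split by blast
  have u': "u = (P + Q - (int m + 1), P - Q)" using u Q by (simp add: P_def)
  \<comment> \<open>These are \<open>0 \<le> d\<close> and \<open>d \<le> m\<close>. Hence
    \<open>P\<close> lies in the block of \<open>Q\<close> or in the next one, which gives the even
    and the odd preimage.\<close>
  have "\<not> P < Q" "\<not> (a + 1) * int m + int x < P"
    using u by (auto simp: P_def x algebra_simps)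
  then have "a < b \<or> a = b \<and> x \<le> y" "b < a + 1 \<or> b = a + 1 \<and> y \<le> x"
    unfolding x(1) y(1) using x y by (subst (asm) (1 2) block_less_iff; force)+
  then consider "b = a" "x \<le> y" | "b = a + 1" "y \<le> x" by linarith
  then show ?thesis
  proof cases
    case 1
    then have "u = one_sec m (2 * a, x, y)" "(2 * a, x, y) \<in> ZS m"
      unfolding one_sec_even u' using x y by (auto simp: ZS_def)
    then show ?thesis by blast
  next
    case 2
    then have "u = one_sec m (2 * a + 1, y, x)" "(2 * a + 1, y, x) \<in> ZS m"
      unfolding one_sec_odd u' using x y by (auto simp: ZS_def)
    then show ?thesis by blast
  qed
qed

section \<open>The symbols of \<open>Omega\<close> and what lies above them\<close>

lemma Omega_in_ZS:
  assumes "m \<ge> 1" "w \<in> Omega m"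
  shows "w \<in> ZS m"
  using assms by (auto simp: Omega_def omega_def bar_def ZS_def split: if_splits)

lemma one_sec_Omega:
  assumes "m \<ge> 1" "w \<in> Omega m"
  shows "one_sec m w \<in> E m (-1) - E m 1"
proof -
  \<comment> \<open>Sizes are written as \<open>2 * a + 1\<close> or \<open>2 * a\<close> to fit
    \<open>one_sec_odd\<close> and \<open>one_sec_even\<close>. The first two families give symbols
    of size -1, the third of size 0.\<close>
  from assms(2) consider "w = (2 * (-1) + 1, m, m)"
    | i where "1 \<le> i" "i \<le> m div 2" "w = (2 * 0, i, m - i)"
    | u where "1 \<le> u" "u \<le> (m + 1) div 2" "w = (2 * 0, u, m + 1 - u)"
    by (auto simp: Omega_def omega_def bar_def split: if_splits)
  then have "fst (one_sec m w) \<in> {-1, 0}"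
    by cases (auto simp only: one_sec_even one_sec_odd, auto)
  moreover have "one_sec m w \<in> E m (-1)"
    using calculation Omega_in_ZS[OF assms] by (intro one_sec_in_E) auto
  ultimately show ?thesis by (auto simp: E_def)
qed

text \<open>The size of \<open>u\<close> exceeds that of \<open>v\<close>, hence is at least 0. Size
  0 would force \<open>v\<close> to have size -1 and the same subscript, against the parity
  condition in \<open>E\<close>.\<close>

lemma above_size_pos:
  assumes "u \<in> E m k" "v \<in> E m (-1)" "strictly_above u v"
  shows "u \<in> E m 1"
proof -
  have "fst u \<noteq> 0 \<or> snd u \<noteq> snd v \<or> fst v \<noteq> -1"
    using assms(1,2) unfolding E_def by clarsimp presburger
  then have "fst u \<ge> 1"
    using assms by (auto simp: strictly_above_def E_def)
  with assms(1) show ?thesis by (auto simp: E_def)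
qed


section \<open>Paths and chains\<close>

text \<open>From the lower symbol, a V-shaped walk opens upwards and is cut off by a zigzag based at
  the height of the other symbol. Neither walk falls below the lower symbol, so the path stays in
  \<open>E m k\<close>.\<close>

lemma path_through_two:
  assumes "u \<in> E m k" "v \<in> E m k" "\<not> strictly_above u v" "\<not> strictly_above v u"
  obtains es where "is_path m k es" "u \<in> set es" "v \<in> set es"
proof -
  have "\<exists>es. is_path m k es \<and> u \<in> set es \<and> v \<in> set es"
    if uv: "u \<in> E m k" "v \<in> E m k" "\<not> strictly_above v u" "fst u \<le> fst v" for u v
  proof -
    obtain l d l' d' where [simp]: "u = (l, d)" "v = (l', d')" by (cases u, cases v)
    have d: "0 \<le> d" "d \<le> int m" "0 \<le> d'" "d' \<le> int m" "k \<le> l" "l \<le> l'"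
      "l' - l \<le> \<bar>d' - d\<bar>"
      and par: "(l - d) mod 2 = (int m + 1) mod 2" "(l' - d') mod 2 = (int m + 1) mod 2"
      using uv by (auto simp: E_def strictly_above_def)
    have par': "even l \<longleftrightarrow> (even d \<longleftrightarrow> odd m)" "even l' \<longleftrightarrow> (even d' \<longleftrightarrow> odd m)"
      using par by presburger+
    \<comment> \<open>The minimum of two walks with steps \<open>\<plusminus>1\<close> and equal parities is again such a walk.\<close>
    define g where "g j = min (l + \<bar>j - d\<bar>) (l' + (j - d') mod 2)" for j
    define es where "es = map (\<lambda>j. (g (int j), int j)) [0..<m + 1]"
    have nth: "es ! j = (g (int j), int j)" if "j \<le> m" for j
      using that by (simp add: es_def del: upt_Suc)
    have g_step: "g (j + 1) = g j + 1 \<or> g (j + 1) = g j - 1" for j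
    proof -
      have a: "\<bar>j + 1 - d\<bar> = \<bar>j - d\<bar> + 1 \<or> \<bar>j + 1 - d\<bar> = \<bar>j - d\<bar> - 1" by linarith
      have b: "(j + 1 - d') mod 2 = (j - d') mod 2 + 1 \<or> (j + 1 - d') mod 2 = (j - d') mod 2 - 1"
        by presburger
      \<comment> \<open>Heights of equal parity cannot change order in one step without meeting, so
        the minimum still moves by exactly 1.\<close>
      have "even ((l + \<bar>j - d\<bar>) - (l' + (j - d') mod 2))"
        using par' by simp argo
      then obtain t where "(l + \<bar>j - d\<bar>) - (l' + (j - d') mod 2) = 2 * t" by (elim evenE)
      with a b show ?thesis unfolding g_def by (smt (verit))
    qed
    have "even (g j - j - (int m + 1))" for j
      using par' unfolding g_def min_def by simp argo
    then have g_par: "(g j - j) mod 2 = (int m + 1) mod 2" for j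
      by (simp add: mod_eq_dvd_iff)
    have g_ge: "k \<le> g j" for j
      using d pos_mod_sign[of 2 "j - d'"] unfolding g_def by linarith
    have "is_path m k es"
      unfolding is_path_def using g_step g_par g_ge
      by (auto simp: nth E_def add.commute[of 1]) (simp_all add: es_def)
    \<comment> \<open>At \<open>d\<close> the tip \<open>l\<close> of the V is the minimum as
      \<open>l \<le> l'\<close>; at \<open>d'\<close> the zigzag is, since
      \<open>l' - l \<le> \<bar>d' - d\<bar>\<close>.\<close>
    moreover have "u = es ! nat d" "v = es ! nat d'"
      using d pos_mod_sign[of 2 "d - d'"] by (auto simp: nth g_def min_def)
    moreover have "nat d < length es" "nat d' < length es"
      using d by (auto simp: es_def)
    ultimately show ?thesis by (metis nth_mem)
  qed
  from this[of u v] this[of v u] assms that show ?thesis by (meson linear)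
qed

text \<open>Along a path the size is a 1-Lipschitz function of the subscript.\<close>

lemma path_not_above:
  assumes "is_path m k es" "u \<in> set es" "v \<in> set es"
  shows "\<not> strictly_above u v"
proof -
  have le: "\<bar>fst (es ! (i + n)) - fst (es ! i)\<bar> \<le> int n" if "i + n \<le> m" for i n
    using that
  proof (induction n)
    case (Suc n)
    then have "fst (es ! (i + n + 1)) = fst (es ! (i + n)) + 1
        \<or> fst (es ! (i + n + 1)) = fst (es ! (i + n)) - 1"
      using assms(1) by (simp add: is_path_def)
    with Suc show ?case by auto
  qed simp
  obtain i j where ij: "i \<le> m" "j \<le> m" "u = es ! i" "v = es ! j"
    using assms by (metis in_set_conv_nth is_path_def less_Suc_eq_le Suc_eq_plus1)
  then have snd: "snd u = int i" "snd v = int j"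
    using assms(1) by (auto simp: is_path_def)
  show ?thesis
  proof (cases "i \<le> j")
    case True
    then show ?thesis using le[of i "j - i"] ij snd by (auto simp: strictly_above_def)
  next
    case False
    then show ?thesis using le[of j "i - j"] ij snd by (auto simp: strictly_above_def)
  qed
qed

section \<open>The frequency condition as comparability of pairs\<close>

lemma distinct_path:
  assumes "is_path m k es"
  shows "distinct es"
  unfolding distinct_conv_nth
proof (intro allI impI)
  fix i j
  assume "i < length es" "j < length es" "i \<noteq> j"
  then have "snd (es ! i) \<noteq> snd (es ! j)"
    using assms by (simp add: is_path_def)
  then show "es ! i \<noteq> es ! j" by metis
qed

lemma sum_list_count_distinct:
  "distinct es \<Longrightarrow> (\<Sum>e\<leftarrow>es. count N e) = size (filter_mset (\<lambda>e. e \<in> set es) N)"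
proof (induction es)
  case (Cons x es)
  have "filter_mset (\<lambda>e. e \<in> set (x # es)) N
      = filter_mset (\<lambda>e. e = x) N + filter_mset (\<lambda>e. e \<in> set es) N"
    using Cons.prems by (intro multiset_eqI) auto
  with Cons show ?case by (simp add: filter_eq_replicate_mset)
qed simp

lemma pair_subset_of_size:
  assumes "2 \<le> size N"
  obtains u v where "{#u, v#} \<subseteq># N"
proof -
  obtain u M where M: "N = add_mset u M" using assms by (cases N) auto
  then obtain v K where "M = add_mset v K" using assms by (cases M) auto
  with M show ?thesis by (intro that[of u v]) simp
qed

text \<open>The bound fails exactly if some path carries two elements of \<open>N\<close>. The pair
  \<open>{#u, v#}\<close> may have \<open>u = v\<close>, so repeated parts are excluded as well,
  \<open>strictly_above\<close> being irreflexive.\<close>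

lemma path_condition_iff:
  assumes "set_mset N \<subseteq> E m k"
  shows "(\<forall>es. is_path m k es \<longrightarrow> (\<Sum>e\<leftarrow>es. count N e) \<le> 1)
    \<longleftrightarrow> (\<forall>u v. {#u, v#} \<subseteq># N \<longrightarrow> strictly_above u v \<or> strictly_above v u)" (is "?L \<longleftrightarrow> ?R")
proof
  assume L: ?L
  show ?R
  proof (intro allI impI, rule ccontr)
    fix u v
    assume sub: "{#u, v#} \<subseteq># N" and "\<not> (strictly_above u v \<or> strictly_above v u)"
    moreover have "u \<in># N" "v \<in># N" using sub by (auto dest: mset_subset_eqD)
    ultimately obtain es where es: "is_path m k es" "u \<in> set es" "v \<in> set es"
      using path_through_two assms by (metis subsetD)
    have "{#u, v#} \<subseteq># filter_mset (\<lambda>e. e \<in> set es) N"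
      using multiset_filter_mono[OF sub, of "\<lambda>e. e \<in> set es"] es by simp
    from size_mset_mono[OF this] show False
      using L es(1) sum_list_count_distinct[OF distinct_path[OF es(1)], of N] by fastforce
  qed
next
  assume R: ?R
  show ?L
  proof (intro allI impI, rule ccontr)
    fix es
    assume es: "is_path m k es" and "\<not> (\<Sum>e\<leftarrow>es. count N e) \<le> 1"
    then have "2 \<le> size (filter_mset (\<lambda>e. e \<in> set es) N)"
      using sum_list_count_distinct[OF distinct_path[OF es], of N] by simp
    then obtain u v where uv: "{#u, v#} \<subseteq># filter_mset (\<lambda>e. e \<in> set es) N"
      by (rule pair_subset_of_size)
    then have "u \<in> set es" "v \<in> set es"
      by (auto dest: mset_subset_eqD)
    moreover have "{#u, v#} \<subseteq># N"
      using uv multiset_filter_subset subset_mset.order_trans by blast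
    ultimately show False using R path_not_above[OF es] by blast
  qed
qed

lemma P_one_iff:
  assumes "w \<in> E m (-1) - E m 1"
  shows "M \<in> P_one m w \<longleftrightarrow> set_mset M \<subseteq> E m 1 \<and>
    (\<forall>u v. {#u, v#} \<subseteq># add_mset w M \<longrightarrow> strictly_above u v \<or> strictly_above v u)"
proof (cases "set_mset M \<subseteq> E m 1")
  case True
  \<comment> \<open>The fictitious frequencies amount to adding one copy of \<open>w\<close>, which
    lies outside \<open>E m 1\<close>.\<close>
  have freq: "freq m w M u = count (add_mset w M) u" for u
    using True assms by (auto simp: freq_def not_in_iff)
  have "set_mset (add_mset w M) \<subseteq> E m (-1)"
    using True assms by (auto simp: E_def)
  from path_condition_iff[OF this] True show ?thesis
    by (simp add: P_one_def freq cong: map_cong)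
next
  case False
  then show ?thesis by (simp add: P_one_def)
qed

text \<open>Of two comparable symbols the upper one has the larger size, so ordering by size orients
  every pair.\<close>

lemma sorted_wrt_aboveI:
  assumes "\<And>u v. {#u, v#} \<subseteq># mset xs \<Longrightarrow> strictly_above u v \<or> strictly_above v u"
    and "sorted_wrt (\<lambda>u v. fst u \<ge> fst v) xs"
  shows "sorted_wrt strictly_above xs"
  using assms
proof (induction xs)
  case (Cons x xs)
  have "strictly_above x v" if v: "v \<in> set xs" for v
  proof -
    have "{#x, v#} \<subseteq># mset (x # xs)" using v by simp
    then have "strictly_above x v \<or> strictly_above v x" by (rule Cons.prems(1))
    moreover have "fst x \<ge> fst v" using Cons.prems(2) v by simp
    ultimately show ?thesis by (auto simp: strictly_above_def)
  qed
  moreover have "sorted_wrt strictly_above xs"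
  proof (rule Cons.IH)
    fix u v
    assume "{#u, v#} \<subseteq># mset xs"
    then have "{#u, v#} \<subseteq># mset (x # xs)"
      by (metis mset.simps(2) mset_subset_eq_add_right add_mset_add_single union_commute
          subset_mset.order_trans)
    then show "strictly_above u v \<or> strictly_above v u" by (rule Cons.prems(1))
  qed (use Cons.prems(2) in simp)
  ultimately show ?case by simp
qed simp

lemma sorted_wrt_above_pairD:
  "sorted_wrt strictly_above xs \<Longrightarrow> {#u, v#} \<subseteq># mset xs \<Longrightarrow> strictly_above u v \<or> strictly_above v u"
proof (induction xs)
  case (Cons x xs)
  show ?case
  proof (cases "u = x \<or> v = x")
    case True
    then show ?thesis using Cons.prems
      by (auto simp: add_mset_commute[of u v] dest: mset_subset_eqD)
  next
    case False
    then have "{#u, v#} \<subseteq># mset xs"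
      using Cons.prems(2) subset_mset.le_diff_conv2
      by (metis mset.simps(2) inter_add_right1 subset_mset.inf.absorb_iff1 set_mset_add_mset_insert
          set_mset_empty insert_iff empty_iff)
    with Cons show ?thesis by simp
  qed
qed simp


section \<open>The bijection\<close>

text \<open>The common image of both sides. The symbol \<open>w\<close> bounds the chain without
  being an entry, as it is not a part of the partition.\<close>

definition chains :: "nat \<Rightarrow> symb \<Rightarrow> symb list set" where
  "chains m w = {xs. set xs \<subseteq> E m 1 \<and> sorted_wrt strictly_above (xs @ [w])}"

lemma bij_betw_chains_P_one:
  assumes "w \<in> E m (-1) - E m 1"
  shows "bij_betw mset (chains m w) (P_one m w)"
proof (rule bij_betw_imageI)
  show "inj_on mset (chains m w)"
    using sorted_wrt_asym_unique[of strictly_above, OF strictly_above_asym]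
    by (intro inj_onI) (simp add: chains_def sorted_wrt_append)
  show "mset ` chains m w = P_one m w"
  proof (intro equalityI subsetI)
    fix M assume "M \<in> mset ` chains m w"
    then obtain xs where xs: "M = mset xs" "set xs \<subseteq> E m 1" "sorted_wrt strictly_above (xs @ [w])"
      by (auto simp: chains_def)
    then show "M \<in> P_one m w"
      using sorted_wrt_above_pairD[OF xs(3)] by (simp add: P_one_iff[OF assms])
  next
    fix M assume "M \<in> P_one m w"
    then have M: "set_mset M \<subseteq> E m 1"
      "\<And>u v. {#u, v#} \<subseteq># add_mset w M \<Longrightarrow> strictly_above u v \<or> strictly_above v u"
      unfolding P_one_iff[OF assms] by blast+
    obtain ys where ys: "mset ys = M" using ex_mset by blast
    define xs where "xs = sort_key (\<lambda>u. - fst u) ys"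
    have xs: "mset xs = M" by (simp add: xs_def ys)
    then have set_xs: "set xs = set_mset M" by auto
    have "sorted (map (\<lambda>u. - fst u) xs)" unfolding xs_def by (rule sorted_sort_key)
    then have "sorted_wrt (\<lambda>u v. fst u \<ge> fst v) xs" by (simp add: sorted_map)
    \<comment> \<open>Parts have size at least 1 and \<open>w\<close> at most 0, so \<open>w\<close>
      can close the list.\<close>
    moreover have "fst w \<le> fst u" if "u \<in> set xs" for u
      using that M(1) assms by (auto simp: set_xs E_def)
    ultimately have "sorted_wrt strictly_above (xs @ [w])"
      by (intro sorted_wrt_aboveI) (auto simp: sorted_wrt_append xs M(2))
    then show "M \<in> mset ` chains m w"
      using xs set_xs M(1) by (auto simp: chains_def intro!: image_eqI[of _ _ xs])
  qed
qed

text \<open>Transitivity of \<open>strictly_above\<close> extends the condition on consecutive parts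
  to all pairs.\<close>

lemma successively_iff_sorted_above:
  assumes "set \<pi> \<subseteq> ZS m"
  shows "successively gg_rho \<pi> \<longleftrightarrow> sorted_wrt strictly_above (map (one_sec m) \<pi>)"
proof -
  have "successively gg_rho \<pi> \<longleftrightarrow> successively (\<lambda>e f. strictly_above (one_sec m e) (one_sec m f)) \<pi>"
    using assms gg_rho_iff_above by (intro successively_cong) blast+
  also have "\<dots> \<longleftrightarrow> successively strictly_above (map (one_sec m) \<pi>)"
    by (simp add: successively_map)
  finally show ?thesis by (simp add: successively_conv_sorted_wrt transp_strictly_above)
qed

lemma bij_betw_P_rho_chains:
  assumes "m \<ge> 1" "w \<in> Omega m"
  shows "bij_betw (\<lambda>\<pi>. map (one_sec m) (butlast \<pi>)) (P_rho m w) (chains m (one_sec m w))"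
proof (rule bij_betw_imageI)
  note w = Omega_in_ZS[OF assms] one_sec_Omega[OF assms]
  show "inj_on (\<lambda>\<pi>. map (one_sec m) (butlast \<pi>)) (P_rho m w)"
  proof (rule inj_onI)
    fix \<pi> \<sigma>
    assume P: "\<pi> \<in> P_rho m w" "\<sigma> \<in> P_rho m w"
      and eq: "map (one_sec m) (butlast \<pi>) = map (one_sec m) (butlast \<sigma>)"
    have "set (butlast \<pi>) \<union> set (butlast \<sigma>) \<subseteq> ZS m"
      using P by (auto simp: P_rho_def dest: in_set_butlastD)
    with eq have "butlast \<pi> = butlast \<sigma>"
      using inj_on_one_sec map_inj_on inj_on_subset by metis
    moreover have "\<pi> = butlast \<pi> @ [w]" "\<sigma> = butlast \<sigma> @ [w]"
      using P append_butlast_last_id by (fastforce simp: P_rho_def)+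
    ultimately show "\<pi> = \<sigma>" by metis
  qed
  show "(\<lambda>\<pi>. map (one_sec m) (butlast \<pi>)) ` P_rho m w = chains m (one_sec m w)"
  proof (intro equalityI subsetI)
    fix xs assume "xs \<in> (\<lambda>\<pi>. map (one_sec m) (butlast \<pi>)) ` P_rho m w"
    then obtain \<pi> where \<pi>: "\<pi> \<in> P_rho m w" "xs = map (one_sec m) (butlast \<pi>)" by auto
    define \<tau> where "\<tau> = butlast \<pi>"
    have "\<pi> = \<tau> @ [w]" using \<pi> by (auto simp: P_rho_def \<tau>_def)
    with \<pi> have \<tau>: "set \<tau> \<subseteq> ZS m" "xs = map (one_sec m) \<tau>" "successively gg_rho (\<tau> @ [w])"
      by (auto simp: P_rho_def)
    have sorted: "sorted_wrt strictly_above (xs @ [one_sec m w])"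
      using successively_iff_sorted_above[of "\<tau> @ [w]" m] \<tau> w by simp
    have "u \<in> E m 1" if u: "u \<in> set xs" for u
    proof -
      obtain e where "e \<in> ZS m" "u = one_sec m e" using \<tau> u by auto
      \<comment> \<open>The bound \<open>fst u\<close> is trivial; positivity of the size comes only
        from lying above the symbol of \<open>w\<close>.\<close>
      then have "u \<in> E m (fst u)" by (simp add: one_sec_in_E)
      moreover have "strictly_above u (one_sec m w)"
        using sorted u by (simp add: sorted_wrt_append)
      ultimately show ?thesis using above_size_pos w by blast
    qed
    with sorted show "xs \<in> chains m (one_sec m w)" by (auto simp: chains_def)
  next
    fix xs assume "xs \<in> chains m (one_sec m w)"
    then have xs: "set xs \<subseteq> E m 1" "sorted_wrt strictly_above (xs @ [one_sec m w])"
      by (auto simp: chains_def)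
    then have "xs \<in> lists (one_sec m ` ZS m)" using one_sec_surj[OF assms(1)] by blast
    then obtain \<tau> where \<tau>: "set \<tau> \<subseteq> ZS m" "xs = map (one_sec m) \<tau>"
      by (auto simp: lists_image)
    have "\<tau> @ [w] \<in> P_rho m w"
      using successively_iff_sorted_above[of "\<tau> @ [w]" m] \<tau> w xs by (simp add: P_rho_def)
    then show "xs \<in> (\<lambda>\<pi>. map (one_sec m) (butlast \<pi>)) ` P_rho m w"
      using \<tau> by (auto intro!: image_eqI[of _ _ "\<tau> @ [w]"])
  qed
qed

section \<open>Weights and finiteness\<close>

lemma one_expo_add: "one_expo m (a + b) = one_expo m a + one_expo m b"
  by (simp add: one_expo_def lookup_add distrib_left distrib_right sum.distrib)

lemma one_expo_seq_mono:
  "set \<pi> \<subseteq> ZS m \<Longrightarrow> one_expo m (seq_mono \<pi>) = of_int (\<Sum>u\<leftarrow>map (one_sec m) \<pi>. fst u)"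
proof (induction \<pi>)
  case Nil
  then show ?case by (simp add: seq_mono_def one_expo_def)
next
  case (Cons e \<pi>)
  then show ?case
    using one_expo_add[of m "sec_mono e" "seq_mono \<pi>"] one_expo_sec_mono[of e m]
    by (simp add: seq_mono_def)
qed

text \<open>Dividing by the monomial of \<open>w\<close> cancels the last part; the exponent is
  additive over the others.\<close>

lemma P_rho_weight:
  assumes "\<pi> \<in> P_rho m w"
  shows "one_expo m (seq_mono \<pi> - sec_mono w)
    = of_int (size_one (mset (map (one_sec m) (butlast \<pi>))))"
proof -
  define \<tau> where "\<tau> = butlast \<pi>"
  have \<pi>: "\<pi> = \<tau> @ [w]" using assms by (auto simp: P_rho_def \<tau>_def)
  then have "set \<tau> \<subseteq> ZS m" using assms by (auto simp: P_rho_def)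
  moreover have "seq_mono \<pi> - sec_mono w = seq_mono \<tau>" by (simp add: \<pi> seq_mono_def)
  moreover have "size_one (mset xs) = (\<Sum>u\<leftarrow>xs. fst u)" for xs
    unfolding size_one_def by (metis mset_map sum_mset_sum_list)
  ultimately show ?thesis by (simp only: one_expo_seq_mono \<tau>_def)
qed

text \<open>Parts have size at least 1, so there are at most \<open>N\<close> of them, each of size
  at most \<open>N\<close> with one of \<open>m + 1\<close> subscripts.\<close>

lemma finite_P_one_size: "finite {M \<in> P_one m w. size_one M = N}"
proof -
  define A where "A = {1..N} \<times> {0..int m}"
  have "M \<in> mset ` {xs. set xs \<subseteq> A \<and> length xs \<le> nat N}"
    if M: "M \<in> P_one m w" "size_one M = N" for M
  proof -
    obtain xs where xs: "mset xs = M" using ex_mset by blast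
    have E: "set xs \<subseteq> E m 1" using M(1) xs by (auto simp: P_one_def)
    have sum: "(\<Sum>u\<leftarrow>xs. fst u) = N"
      using M(2) unfolding size_one_def xs[symmetric] by (metis mset_map sum_mset_sum_list)
    have pos: "1 \<le> fst u" "u \<in> {1..fst u} \<times> {0..int m}" if "u \<in> set xs" for u
      using that E by (auto simp: E_def)
    have "int (length xs) = (\<Sum>u\<leftarrow>xs. 1)" by (simp add: sum_list_triv)
    also have "\<dots> \<le> (\<Sum>u\<leftarrow>xs. fst u)" using pos by (intro sum_list_mono) auto
    finally have "length xs \<le> nat N" using sum by simp
    moreover have "fst u \<le> N" if "u \<in> set xs" for u
      unfolding sum[symmetric] using that pos by (intro member_le_sum_list) force+
    ultimately have "set xs \<subseteq> A" "length xs \<le> nat N"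
      using pos by (fastforce simp: A_def)+
    with xs show ?thesis by blast
  qed
  moreover have "finite (mset ` {xs. set xs \<subseteq> A \<and> length xs \<le> nat N})"
    by (intro finite_imageI finite_lists_length_le) (simp add: A_def)
  ultimately show ?thesis by (elim finite_subset[rotated]) blast
qed


section \<open>Generating functions\<close>

text \<open>Counting by monomial and then collecting monomials of equal exponent is counting by
  exponent. Finiteness of the exponent classes yields that of the monomial classes and of the sums
  in the substitution.\<close>

lemma gen_series_substitution:
  fixes wt :: "'a \<Rightarrow> mono" and \<nu> :: mono
  assumes fin: "\<And>N. finite {\<pi> \<in> S. one_expo m (wt \<pi> - \<nu>) = N}"
  shows "gen_series_defined wt S"
    and "one_series_defined m (monom_times (- \<nu>) (gen_series wt S))"
    and "one_series m (monom_times (- \<nu>) (gen_series wt S))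
      = gen_series (\<lambda>\<pi>. one_expo m (wt \<pi> - \<nu>)) S"
proof -
  let ?F = "monom_times (- \<nu>) (gen_series wt S)"
  have finwt: "finite {\<pi> \<in> S. wt \<pi> = \<mu>}" for \<mu>
    by (rule finite_subset[OF _ fin[of "one_expo m (\<mu> - \<nu>)"]]) auto
  then show "gen_series_defined wt S" by (simp add: gen_series_defined_def)
  have F: "?F \<mu> = int (card {\<pi> \<in> S. wt \<pi> - \<nu> = \<mu>})" for \<mu>
    by (simp add: monom_times_def gen_series_def diff_eq_eq)
  have fin': "finite {\<pi> \<in> S. wt \<pi> - \<nu> = \<mu>}" for \<mu>
    using finwt[of "\<mu> + \<nu>"] by (simp add: diff_eq_eq)
  \<comment> \<open>With finite fibres, a coefficient is nonzero exactly if its monomial occurs, so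
    the substitution sums over an image and \<open>sum.image_gen\<close> applies.\<close>
  have support: "{\<mu>. ?F \<mu> \<noteq> 0 \<and> one_expo m \<mu> = N}
      = (\<lambda>\<pi>. wt \<pi> - \<nu>) ` {\<pi> \<in> S. one_expo m (wt \<pi> - \<nu>) = N}" for N
  proof (intro set_eqI iffI)
    fix \<mu>
    assume \<mu>: "\<mu> \<in> {\<mu>. ?F \<mu> \<noteq> 0 \<and> one_expo m \<mu> = N}"
    then have "card {\<pi> \<in> S. wt \<pi> - \<nu> = \<mu>} \<noteq> 0" by (simp add: F)
    then have "{\<pi> \<in> S. wt \<pi> - \<nu> = \<mu>} \<noteq> {}" by fastforce
    then obtain \<pi> where "\<pi> \<in> S" "\<mu> = wt \<pi> - \<nu>" by blast
    then show "\<mu> \<in> (\<lambda>\<pi>. wt \<pi> - \<nu>) ` {\<pi> \<in> S. one_expo m (wt \<pi> - \<nu>) = N}"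
      using \<mu> by (intro image_eqI[of _ _ \<pi>]) simp_all
  next
    fix \<mu>
    assume "\<mu> \<in> (\<lambda>\<pi>. wt \<pi> - \<nu>) ` {\<pi> \<in> S. one_expo m (wt \<pi> - \<nu>) = N}"
    then obtain \<pi> where \<pi>: "\<mu> = wt \<pi> - \<nu>" "\<pi> \<in> {\<pi> \<in> S. one_expo m (wt \<pi> - \<nu>) = N}"
      by (rule imageE)
    then have "\<pi> \<in> {\<pi> \<in> S. wt \<pi> - \<nu> = \<mu>}" by simp
    with fin'[of \<mu>] have "card {\<pi> \<in> S. wt \<pi> - \<nu> = \<mu>} \<noteq> 0"
      unfolding card_eq_0_iff by blast
    with \<pi> show "\<mu> \<in> {\<mu>. ?F \<mu> \<noteq> 0 \<and> one_expo m \<mu> = N}" by (simp add: F)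
  qed
  show "one_series_defined m ?F"
    unfolding one_series_defined_def support using fin by blast
  show "one_series m ?F = gen_series (\<lambda>\<pi>. one_expo m (wt \<pi> - \<nu>)) S"
  proof
    fix N
    let ?A = "{\<pi> \<in> S. one_expo m (wt \<pi> - \<nu>) = N}"
    have "one_series m ?F N = (\<Sum>\<mu>\<in>(\<lambda>\<pi>. wt \<pi> - \<nu>) ` ?A. int (card {\<pi> \<in> S. wt \<pi> - \<nu> = \<mu>}))"
      unfolding one_series_def support unfolding F ..
    also have "\<dots> = (\<Sum>\<mu>\<in>(\<lambda>\<pi>. wt \<pi> - \<nu>) ` ?A. \<Sum>\<pi> | \<pi> \<in> ?A \<and> wt \<pi> - \<nu> = \<mu>. 1)"
      by (intro sum.cong refl) (auto intro!: arg_cong[where f = card])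
    also have "\<dots> = (\<Sum>\<pi>\<in>?A. 1)"
      by (rule sum.image_gen[OF fin, symmetric])
    finally show "one_series m ?F N = gen_series (\<lambda>\<pi>. one_expo m (wt \<pi> - \<nu>)) S N"
      by (simp add: gen_series_def)
  qed
qed

lemma bij_betw_fibres:
  assumes "bij_betw f S T" "\<And>x. x \<in> S \<Longrightarrow> wt' (f x) = wt x"
  shows "bij_betw f {x \<in> S. wt x = \<mu>} {y \<in> T. wt' y = \<mu>}"
  using assms by (auto simp: bij_betw_def inj_on_def)

theorem theorem5p12:
  fixes m :: nat and w :: sec
  assumes "m \<ge> 1" and "w \<in> Omega m"
  shows "gen_series_defined (\<lambda>\<pi>. rat_of_int (size_one \<pi>)) (P_one m (one_sec m w))
    \<and> gen_series_defined seq_mono (P_rho m w)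
    \<and> one_series_defined m (monom_times (- sec_mono w) (gen_series seq_mono (P_rho m w)))
    \<and> gen_series (\<lambda>\<pi>. rat_of_int (size_one \<pi>)) (P_one m (one_sec m w))
        = one_series m (monom_times (- sec_mono w) (gen_series seq_mono (P_rho m w)))"
proof -
  let ?\<Phi> = "\<lambda>\<pi>. mset (map (one_sec m) (butlast \<pi>))"
  let ?size = "\<lambda>\<pi>. rat_of_int (size_one \<pi>)"
  let ?expo = "\<lambda>\<pi>. one_expo m (seq_mono \<pi> - sec_mono w)"
  have "bij_betw ?\<Phi> (P_rho m w) (P_one m (one_sec m w))"
    using bij_betw_trans[OF bij_betw_P_rho_chains[OF assms]
        bij_betw_chains_P_one[OF one_sec_Omega[OF assms]]] by (simp add: comp_def)
  then have bij: "bij_betw ?\<Phi> {\<pi> \<in> P_rho m w. ?expo \<pi> = N}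
      {\<pi> \<in> P_one m (one_sec m w). ?size \<pi> = N}" for N
    by (rule bij_betw_fibres) (simp only: P_rho_weight)
  \<comment> \<open>Exponents are rational but sizes are integers: only an integral \<open>N\<close>
    has a nonempty class, and then \<open>N\<close> is its own floor.\<close>
  have fin: "finite {\<pi> \<in> P_one m (one_sec m w). ?size \<pi> = N}" for N
    by (rule finite_subset[OF _ finite_P_one_size[of m _ "\<lfloor>N\<rfloor>"]]) auto
  then have fin': "finite {\<pi> \<in> P_rho m w. ?expo \<pi> = N}" for N
    using bij_betw_finite[OF bij] by blast
  have "gen_series ?size (P_one m (one_sec m w)) = gen_series ?expo (P_rho m w)"
    using bij_betw_same_card[OF bij] by (simp add: gen_series_def)
  with fin gen_series_substitution[OF fin'] show ?thesis
    by (simp add: gen_series_defined_def)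
qed

end
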